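(* Let $(X,\rho)$ be a compact metric space of diameter $1$ and let $T\colon X\to X$ be a continuous map. If $(X,T)$ has the partial specification property, then $(X,T)$ has the average shadowing property.
   Context: Here $\mathbb{N}=\{0,1,2,\dots\}$. Specifications. For $x\in X$ and $a<b$ in $\mathbb{N}$, $T^{[a,b)}(x)$ denotes the orbit segment $T^a(x),T^{a+1}(x),\dots,T^{b-1}(x)$. For $M\in\mathbb{N}$, a finite collection $\{T^{[a_i,b_i)}(x_i)\}_{i=1}^r$ ($r\ge 1$, $x_i\in X$, $a_i,b_i\in\mathbb{N}$) is an $M$-spaced specification if $a_1<b_1<a_2<b_2<\dots<a_r<b_r$ and $a_i-b_{i-1}\ge M$ for $i=2,\dots,r$. It is $\varepsilon$-partially traced by $z\in X$ if for every $1\le i\le r$ we have $|\Lambda_i|/(b_i-a_i)>1-\varepsilon$, where $\Lambda_i=\{a_i\le n<b_i : \rho(T^n(z),T^n(x_i))<\varepsilon\}$. Partial specification. Let $P\subset\mathbb{N}$. $(X,T)$ has the partial specification property with periods $P$ if for every $\varepsilon>0$ there exist $M,N\in\mathbb{N}$ such that for every $M$-spaced specification $\{T^{[a_i,b_i)}(x_i)\}_{i=1}^r$ and every $n\in P$ with $n\ge\max\{N,(1+\varepsilon)b_r\}$ there is a point $z\in X$ of period $n$ (i.e. $T^n(z)=z$) which $\varepsilon$-partially traces the specification. $(X,T)$ has the partial specification property if for every $c\in\mathbb{N}$ there is $P\subset c\mathbb{N}$ such that $(X,T)$ has the partial specification property with periods $P$. Average shadowing. For $\delta>0$, a sequence $\{x_i\}_{i=0}^\infty$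 in $X$ is a $\delta$-average pseudo-orbit for $T$ if there is a positive integer $N$ such that for all $n\ge N$ and $k\ge 0$, $\frac1n\sum_{i=0}^{n-1}\rho(T(x_{i+k}),x_{i+k+1})<\delta$. $(X,T)$ has the average shadowing property if for every $\varepsilon>0$ there is $\delta>0$ such that for every $\delta$-average pseudo-orbit $\{x_i\}_{i=0}^\infty$ there is $z\in X$ with $\limsup_{n\to\infty}\frac1n\sum_{j=0}^{n-1}\rho(T^j(z),x_j)<\varepsilon$.
   Formalization: In the partial specification property the set of periods P is required to be infinite and c ranges over c ≥ 1; with finite or empty P every system has the property vacuously and the claim fails, e.g. for the identity on two points. *)

theory Defs
  imports "HOL-Analysis.Analysis"
begin

text \<open>
  The phase space is a subset \<open>X\<close> of a type of class \<open>metric_space\<close>, with metric \<open>dist\<close>.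
  A specification with \<open>r\<close> segments is given by functions \<open>x\<close>, \<open>a\<close>, \<open>b\<close>, of which only the
  values at the indices \<open>1, \<dots>, r\<close> matter: the \<open>i\<close>-th segment is
  \<open>(T ^^ n) (x i)\<close> for \<open>a i \<le> n < b i\<close>.
\<close>

definition spaced_specification ::
  "'a set \<Rightarrow> nat \<Rightarrow> nat \<Rightarrow> (nat \<Rightarrow> 'a) \<Rightarrow> (nat \<Rightarrow> nat) \<Rightarrow> (nat \<Rightarrow> nat) \<Rightarrow> bool" where
  "spaced_specification X M r x a b \<longleftrightarrow>
     1 \<le> r \<and>
     (\<forall>i\<in>{1..r}. x i \<in> X \<and> a i < b i) \<and>
     (\<forall>i\<in>{2..r}. b (i - 1) < a i \<and> M \<le> a i - b (i - 1))"

definition partially_traced ::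
  "('a::metric_space \<Rightarrow> 'a) \<Rightarrow> real \<Rightarrow> nat \<Rightarrow> (nat \<Rightarrow> 'a) \<Rightarrow> (nat \<Rightarrow> nat) \<Rightarrow> (nat \<Rightarrow> nat) \<Rightarrow> 'a \<Rightarrow> bool" where
  "partially_traced T \<epsilon> r x a b z \<longleftrightarrow>
     (\<forall>i\<in>{1..r}.
        real (card {n. a i \<le> n \<and> n < b i \<and> dist ((T ^^ n) z) ((T ^^ n) (x i)) < \<epsilon>})
          / real (b i - a i) > 1 - \<epsilon>)"

definition partial_specification_with_periods ::
  "'a::metric_space set \<Rightarrow> ('a \<Rightarrow> 'a) \<Rightarrow> nat set \<Rightarrow> bool" where
  "partial_specification_with_periods X T P \<longleftrightarrow>
     (\<forall>\<epsilon>>0. \<exists>M N. \<forall>r x a b. spaced_specification X M r x a b \<longrightarrow>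
        (\<forall>n\<in>P. real n \<ge> max (real N) ((1 + \<epsilon>) * real (b r)) \<longrightarrow>
           (\<exists>z\<in>X. (T ^^ n) z = z \<and> partially_traced T \<epsilon> r x a b z)))"

text \<open>
  The set of periods has to be infinite: for finite \<open>P\<close> the previous property holds vacuously,
  by taking \<open>N\<close> above all elements of \<open>P\<close>. Accordingly \<open>c\<close> ranges over the positive
  integers, since no infinite \<open>P\<close> consists of multiples of \<open>0\<close>.
\<close>

definition partial_specification_property ::
  "'a::metric_space set \<Rightarrow> ('a \<Rightarrow> 'a) \<Rightarrow> bool" where
  "partial_specification_property X T \<longleftrightarrow>
     (\<forall>c\<ge>1. \<exists>P. infinite P \<and> P \<subseteq> {c * k |k. True} \<and> partial_specification_with_periods X T P)"

definition average_pseudo_orbit ::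
  "'a::metric_space set \<Rightarrow> ('a \<Rightarrow> 'a) \<Rightarrow> real \<Rightarrow> (nat \<Rightarrow> 'a) \<Rightarrow> bool" where
  "average_pseudo_orbit X T \<delta> x \<longleftrightarrow>
     (\<forall>i. x i \<in> X) \<and>
     (\<exists>N>0. \<forall>n\<ge>N. \<forall>k. 1 / real n * (\<Sum>i<n. dist (T (x (i + k))) (x (i + k + 1))) < \<delta>)"

text \<open>The upper limit is taken in \<open>ereal\<close>, as \<open>limsup\<close> needs a complete order.\<close>

definition average_shadowing_property ::
  "'a::metric_space set \<Rightarrow> ('a \<Rightarrow> 'a) \<Rightarrow> bool" where
  "average_shadowing_property X T \<longleftrightarrow>
     (\<forall>\<epsilon>>0. \<exists>\<delta>>0. \<forall>x. average_pseudo_orbit X T \<delta> x \<longrightarrow>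
        (\<exists>z\<in>X. limsup (\<lambda>n. ereal (1 / real n * (\<Sum>j<n. dist ((T ^^ j) z) (x j)))) < ereal \<epsilon>))"

end

theory Submission
  imports Defs
begin

text \<open>
  Cut time into blocks of a length \<open>L\<close> that is large compared with the gap \<open>M\<close> of the
  partial specification property. On a block in which all errors of the pseudo-orbit are small,
  the pseudo-orbit stays close to the true orbit of its initial point, and the number of
  other blocks is controlled by Markov's inequality. To use these orbit segments at their actual
  time \<open>j * L\<close> one needs preimages under \<open>T ^^ (j * L)\<close>, although \<open>T\<close> need not be
  surjective: replace the initial point by a periodic point which partially traces its segment.
  A point tracing all the segments is a limit of points tracing finitely many of them. Partial
  tracing is used only through bounds on sums of distances, which survive this limit.
\<close>

section \<open>Iterates of a self-map and preimages of periodic points\<close>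

lemma funpow_in_self_map:
  assumes "T ` X \<subseteq> X" "x \<in> X"
  shows "(T ^^ n) x \<in> X"
  using assms by (induction n) auto

lemma continuous_on_funpow:
  assumes "continuous_on X T" "T ` X \<subseteq> X"
  shows "continuous_on X (T ^^ n)"
proof (induction n)
  case 0
  then show ?case by (simp add: id_def)
next
  case (Suc n)
  have "(T ^^ n) ` X \<subseteq> X"
    using funpow_in_self_map[OF assms(2)] by blast
  then have "continuous_on X (T \<circ> (T ^^ n))"
    using Suc assms(1) by (intro continuous_on_compose) (auto intro: continuous_on_subset)
  then show ?case by simp
qed

text \<open>The orbit of \<open>p\<close> is a cycle, so running forward \<open>n * k - k\<close>
  steps is as good as going back \<open>k\<close> steps: \<open>k\<close> further steps complete
  \<open>k\<close> full periods.\<close>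

lemma periodic_point_preimage:
  assumes "(T ^^ n) p = p" "n > 0" "T ` X \<subseteq> X" "p \<in> X"
  obtains q where "q \<in> X" "(T ^^ k) q = p"
proof
  show "(T ^^ (n * k - k)) p \<in> X"
    using funpow_in_self_map[OF assms(3,4)] .
  have "k \<le> n * k" using assms(2) by simp
  then have "(T ^^ k) ((T ^^ (n * k - k)) p) = (T ^^ (n * k)) p"
    by (metis funpow_add comp_apply le_add_diff_inverse)
  also have "\<dots> = p"
  proof (induction k)
    case (Suc k)
    then show ?case using assms(1) by (simp add: funpow_add)
  qed simp
  finally show "(T ^^ k) ((T ^^ (n * k - k)) p) = p" .
qed

section \<open>From partial tracing to bounds on sums of distances\<close>

text \<open>Each good time contributes less than \<open>\<epsilon>\<close>. The bad times make up
  less than a fraction \<open>\<epsilon>\<close> of the segment and contribute at most 1 each.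
  Together this gives the factor 2.\<close>

lemma partially_traced_sum_le:
  assumes tr: "partially_traced T \<epsilon> r x a b z" and i: "i \<in> {1..r}" and ab: "a i < b i"
    and le1: "\<And>n. dist ((T ^^ n) z) ((T ^^ n) (x i)) \<le> 1"
    and eps: "\<epsilon> > 0"
  shows "(\<Sum>n=a i..<b i. dist ((T ^^ n) z) ((T ^^ n) (x i))) \<le> 2 * \<epsilon> * real (b i - a i)"
proof -
  let ?d = "\<lambda>n. dist ((T ^^ n) z) ((T ^^ n) (x i))"
  let ?G = "{n. a i \<le> n \<and> n < b i \<and> ?d n < \<epsilon>}"
  have sub: "?G \<subseteq> {a i..<b i}" by auto
  then have fin: "finite ?G" using finite_subset by blast
  have "real (card ?G) / real (b i - a i) > 1 - \<epsilon>"
    using tr i unfolding partially_traced_def by blast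
  then have card_gt: "real (card ?G) > real (b i - a i) - real (b i - a i) * \<epsilon>"
    using ab by (simp only: pos_less_divide_eq of_nat_0_less_iff zero_less_diff left_diff_distrib)
      (simp add: mult.commute)
  have cardG: "card ?G \<le> b i - a i"
    using card_mono[OF _ sub] by simp
  have "sum ?d {a i..<b i} = sum ?d ?G + sum ?d ({a i..<b i} - ?G)"
    using sum.subset_diff[OF sub] by (simp add: add.commute)
  moreover have "sum ?d ?G \<le> real (card ?G) * \<epsilon>"
    by (rule sum_bounded_above) auto
  moreover have "real (card ?G) * \<epsilon> \<le> real (b i - a i) * \<epsilon>"
    using cardG eps by (intro mult_right_mono) auto
  moreover have "sum ?d ({a i..<b i} - ?G) \<le> real (card ({a i..<b i} - ?G)) * 1"
    by (rule sum_bounded_above) (rule le1)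
  moreover have "real (card ({a i..<b i} - ?G)) = real (b i - a i) - real (card ?G)"
    using card_Diff_subset[OF fin sub] cardG by (simp add: of_nat_diff)
  ultimately have "sum ?d {a i..<b i} \<le> 2 * (real (b i - a i) * \<epsilon>)"
    using card_gt by linarith
  then show ?thesis by (simp only: ac_simps)
qed

text \<open>Since \<open>P\<close> is infinite, it contains a period beyond any threshold, so the
  lower bound on the period disappears from the conclusion. The tracing point is still recorded as
  periodic, because preimages of it are needed later.\<close>

lemma partial_specification_traces_finite:
  assumes "T ` X \<subseteq> X" and le1: "\<And>u v. u \<in> X \<Longrightarrow> v \<in> X \<Longrightarrow> dist u v \<le> 1"
    and P: "infinite P" "partial_specification_with_periods X T P" and eps: "\<epsilon> > 0"
  obtains M where "\<And>r x a b. spaced_specification X M r x a b \<Longrightarrow>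
    \<exists>n>0. \<exists>z\<in>X. (T ^^ n) z = z \<and>
      (\<forall>i\<in>{1..r}. (\<Sum>n=a i..<b i. dist ((T ^^ n) z) ((T ^^ n) (x i))) \<le> 2 * \<epsilon> * real (b i - a i))"
proof -
  from P(2) eps obtain M N where MN: "\<And>r x a b n. spaced_specification X M r x a b \<Longrightarrow> n \<in> P \<Longrightarrow>
      real n \<ge> max (real N) ((1 + \<epsilon>) * real (b r)) \<Longrightarrow>
      \<exists>z\<in>X. (T ^^ n) z = z \<and> partially_traced T \<epsilon> r x a b z"
    unfolding partial_specification_with_periods_def by meson
  show thesis
  proof (rule that)
    fix r and x :: "nat \<Rightarrow> 'a" and a b
    assume spec: "spaced_specification X M r x a b"
    obtain k where k: "max (real N) ((1 + \<epsilon>) * real (b r)) \<le> real k"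
      using real_arch_simple by blast
    \<comment> \<open>\<open>Suc k\<close> instead of \<open>k\<close> ensures that the period is
      positive.\<close>
    obtain n where n: "n \<in> P" "n \<ge> Suc k"
      using P(1) unfolding infinite_nat_iff_unbounded_le by blast
    with k have "max (real N) ((1 + \<epsilon>) * real (b r)) \<le> real n" by linarith
    from MN[OF spec n(1) this] obtain z
      where z: "z \<in> X" "(T ^^ n) z = z" "partially_traced T \<epsilon> r x a b z" by blast
    have "(\<Sum>n=a i..<b i. dist ((T ^^ n) z) ((T ^^ n) (x i))) \<le> 2 * \<epsilon> * real (b i - a i)"
      if i: "i \<in> {1..r}" for i
    proof (rule partially_traced_sum_le[OF z(3) i _ _ eps])
      show "a i < b i" using spec i unfolding spaced_specification_def by blast
      have "x i \<in> X" using spec i unfolding spaced_specification_def by blast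
      then show "dist ((T ^^ n) z) ((T ^^ n) (x i)) \<le> 1" for n
        using le1 funpow_in_self_map[OF assms(1)] z(1) by blast
    qed
    then show "\<exists>n>0. \<exists>z\<in>X. (T ^^ n) z = z \<and>
      (\<forall>i\<in>{1..r}. (\<Sum>n=a i..<b i. dist ((T ^^ n) z) ((T ^^ n) (x i))) \<le> 2 * \<epsilon> * real (b i - a i))"
      using z(1,2) n(2) by (intro exI[of _ n]) auto
  qed
qed

text \<open>For fixed \<open>i\<close>, the sum is a finite sum of continuous functions of the
  tracing point, so its non-strict bound passes to a subsequential limit of the points that trace
  the first \<open>r\<close> segments.\<close>

lemma traces_infinite_of_traces_finite:
  fixes T :: "'a::metric_space \<Rightarrow> 'a" and x :: "nat \<Rightarrow> 'a"
  assumes "compact X" "T ` X \<subseteq> X" "continuous_on X T"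
    and fin: "\<And>r. \<exists>z\<in>X. \<forall>i<r. (\<Sum>n=a i..<b i. dist ((T ^^ n) z) ((T ^^ n) (x i))) \<le> B i"
  obtains z where "z \<in> X" "\<And>i. (\<Sum>n=a i..<b i. dist ((T ^^ n) z) ((T ^^ n) (x i))) \<le> B i"
proof -
  from fin obtain Z :: "nat \<Rightarrow> 'a" where Z: "\<And>r. Z r \<in> X"
    "\<And>r i. i < r \<Longrightarrow> (\<Sum>n=a i..<b i. dist ((T ^^ n) (Z r)) ((T ^^ n) (x i))) \<le> B i"
    by metis
  from assms(1) Z(1) obtain z f where z: "z \<in> X" "strict_mono f" "(Z \<circ> f) \<longlonglongrightarrow> z"
    unfolding compact_def by meson
  show thesis
  proof (rule that[OF z(1)])
    fix i
    have conv: "(\<lambda>r. (T ^^ n) (Z (f r))) \<longlonglongrightarrow> (T ^^ n) z" for n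
      using continuous_on_tendsto_compose[OF continuous_on_funpow[OF assms(3,2)] z(3,1)] Z(1)
      by simp
    have "(\<lambda>r. \<Sum>n=a i..<b i. dist ((T ^^ n) (Z (f r))) ((T ^^ n) (x i)))
        \<longlonglongrightarrow> (\<Sum>n=a i..<b i. dist ((T ^^ n) z) ((T ^^ n) (x i)))"
      by (intro tendsto_sum tendsto_dist conv tendsto_const)
    moreover have "\<exists>N. \<forall>r\<ge>N. (\<Sum>n=a i..<b i. dist ((T ^^ n) (Z (f r))) ((T ^^ n) (x i))) \<le> B i"
    proof (intro exI[of _ "Suc i"] allI impI)
      fix r assume "Suc i \<le> r"
      then have "i < f r" using seq_suble[OF z(2), of r] by linarith
      then show "(\<Sum>n=a i..<b i. dist ((T ^^ n) (Z (f r))) ((T ^^ n) (x i))) \<le> B i"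
        by (rule Z(2))
    qed
    ultimately show "(\<Sum>n=a i..<b i. dist ((T ^^ n) z) ((T ^^ n) (x i))) \<le> B i"
      by (rule LIMSEQ_le_const2)
  qed
qed

section \<open>Pseudo-orbits and averages over blocks\<close>

text \<open>Induction on the length: uniform continuity of \<open>T\<close> keeps the distance
  reached after \<open>L\<close> steps below \<open>\<epsilon> / 2\<close> under one more
  application of \<open>T\<close>, and the new error costs another
  \<open>\<epsilon> / 2\<close>.\<close>

lemma pseudo_orbit_close_to_orbit:
  fixes T :: "'a::metric_space \<Rightarrow> 'a"
  assumes "compact X" "T ` X \<subseteq> X" "continuous_on X T" "\<epsilon> > 0"
  shows "\<exists>\<eta>>0. \<forall>u. (\<forall>i. u i \<in> X) \<longrightarrow> (\<forall>i<L. dist (T (u i)) (u (Suc i)) < \<eta>) \<longrightarrow>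
    (\<forall>i\<le>L. dist ((T ^^ i) (u 0)) (u i) < \<epsilon>)"
  using assms(4)
proof (induction L arbitrary: \<epsilon>)
  case 0
  then show ?case by (auto intro: exI[of _ 1])
next
  case (Suc L)
  have "uniformly_continuous_on X T"
    using compact_uniformly_continuous assms(1,3) by blast
  then obtain \<gamma> where \<gamma>: "\<gamma> > 0"
    "\<And>u v. u \<in> X \<Longrightarrow> v \<in> X \<Longrightarrow> dist u v < \<gamma> \<Longrightarrow> dist (T u) (T v) < \<epsilon> / 2"
    unfolding uniformly_continuous_on_def using Suc.prems by (metis half_gt_zero)
  \<comment> \<open>Closeness \<open>\<gamma>\<close> at time \<open>L\<close> feeds the next step;
    closeness \<open>\<epsilon>\<close> settles the times up to \<open>L\<close>.\<close>
  obtain \<eta> where \<eta>: "\<eta> > 0"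
    "\<And>u i. (\<forall>i. u i \<in> X) \<Longrightarrow> (\<forall>i<L. dist (T (u i)) (u (Suc i)) < \<eta>) \<Longrightarrow> i \<le> L \<Longrightarrow>
      dist ((T ^^ i) (u 0)) (u i) < min \<gamma> \<epsilon>"
    using Suc.IH[of "min \<gamma> \<epsilon>"] \<gamma>(1) Suc.prems by (metis min_less_iff_conj)
  show ?case
  proof (intro exI[of _ "min \<eta> (\<epsilon> / 2)"] conjI allI impI)
    show "min \<eta> (\<epsilon> / 2) > 0" using \<eta>(1) Suc.prems by simp
    fix u i
    assume u: "\<forall>i. u i \<in> X" "\<forall>i<Suc L. dist (T (u i)) (u (Suc i)) < min \<eta> (\<epsilon> / 2)" "i \<le> Suc L"
    have close: "dist ((T ^^ i) (u 0)) (u i) < min \<gamma> \<epsilon>" if "i \<le> L" for i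
      using \<eta>(2)[OF u(1) _ that] u(2) by simp
    show "dist ((T ^^ i) (u 0)) (u i) < \<epsilon>"
    proof (cases "i \<le> L")
      case True
      then show ?thesis using close by simp
    next
      case False
      with u(3) have i: "i = Suc L" by simp
      have "dist (T ((T ^^ L) (u 0))) (T (u L)) < \<epsilon> / 2"
        using \<gamma>(2) funpow_in_self_map[OF assms(2)] u(1) close[of L] by simp
      moreover have "dist (T (u L)) (u (Suc L)) < \<epsilon> / 2"
        using u(2) by simp
      ultimately have "dist (T ((T ^^ L) (u 0))) (u (Suc L)) < \<epsilon>"
        using dist_triangle_half_l dist_commute by metis
      then show ?thesis using i by simp
    qed
  qed
qed

text \<open>Extend the sum over \<open>n\<close> terms to whole blocks, which is possible as
  \<open>f\<close> is nonnegative. The block bounds then give an average of at most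
  \<open>c\<close>, plus at most \<open>C * \<delta> \<le> c\<close> from the errors
  \<open>e\<close>. Rounding up costs a factor of at most 3/2, hence \<open>3 * c\<close>.\<close>

lemma limsup_average_le_of_block_sums:
  fixes f e :: "nat \<Rightarrow> real"
  assumes f0: "\<And>n. f n \<ge> 0" and "L > 0" and C: "C \<ge> 0" and c: "c > 0"
    and block: "\<And>j. (\<Sum>i<L. f (j * L + i)) \<le> real L * c + C * (\<Sum>i<L. e (j * L + i))"
    and e: "\<And>n. n \<ge> N \<Longrightarrow> (\<Sum>i<n. e i) \<le> \<delta> * real n" and \<delta>: "C * \<delta> \<le> c"
  shows "limsup (\<lambda>n. ereal (1 / real n * (\<Sum>i<n. f i))) \<le> ereal (3 * c)"
proof (rule Limsup_bounded)
  have blocks: "(\<Sum>i<m * L. g i) = (\<Sum>j<m. \<Sum>i<L. g (j * L + i))" for g :: "nat \<Rightarrow> real" and m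
  proof -
    have "sum g {k..<k + L} = (\<Sum>i<L. g (k + i))" for k
      using sum.shift_bounds_nat_ivl[of g 0 k L] by (simp add: lessThan_atLeast0 add.commute)
    then have "(\<Sum>j<m. \<Sum>i<L. g (j * L + i)) = (\<Sum>j<m. sum g {j * L..<j * L + L})"
      by simp
    then show ?thesis by (simp add: sum.nat_group)
  qed
  show "\<forall>\<^sub>F n in sequentially. ereal (1 / real n * (\<Sum>i<n. f i)) \<le> ereal (3 * c)"
  proof (rule eventually_sequentiallyI)
    \<comment> \<open>With \<open>n \<ge> 2 * L\<close>, the rounded length is at most
      \<open>n + L \<le> 3 / 2 * n\<close>.\<close>
    fix n assume n: "n \<ge> max N (2 * L)"
    define m where "m = Suc (n div L)"
    have mL: "n \<le> m * L" "m * L \<le> n + L"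
      using \<open>L > 0\<close> dividend_less_div_times[of L n] div_times_less_eq_dividend[of n L]
      unfolding m_def by (auto simp: add.commute)
    have "(\<Sum>i<n. f i) \<le> (\<Sum>i<m * L. f i)"
      using mL(1) f0 by (intro sum_mono2) auto
    also have "\<dots> = (\<Sum>j<m. \<Sum>i<L. f (j * L + i))" by (rule blocks)
    also have "\<dots> \<le> (\<Sum>j<m. real L * c + C * (\<Sum>i<L. e (j * L + i)))"
      by (intro sum_mono block)
    also have "\<dots> = real (m * L) * c + C * (\<Sum>i<m * L. e i)"
      unfolding blocks by (simp add: sum.distrib sum_distrib_left)
    also have "\<dots> \<le> real (m * L) * c + C * (\<delta> * real (m * L))"
      using e[of "m * L"] n mL(1) C by (intro add_left_mono mult_left_mono) auto
    also have "\<dots> = real (m * L) * c + (C * \<delta>) * real (m * L)" by simp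
    also have "\<dots> \<le> real (m * L) * c + c * real (m * L)"
      using \<delta> by (intro add_left_mono mult_right_mono) auto
    also have "\<dots> = 2 * c * real (m * L)" by simp
    also have "\<dots> \<le> 2 * c * real (n + L)"
      using mL(2) c by (intro mult_left_mono of_nat_mono) auto
    also have "\<dots> \<le> 2 * c * (3 / 2 * real n)"
      using n c by (intro mult_left_mono) auto
    finally have "(\<Sum>i<n. f i) \<le> 3 * c * real n" by simp
    moreover have "n > 0" using n \<open>L > 0\<close> by simp
    ultimately show "ereal (1 / real n * (\<Sum>i<n. f i)) \<le> ereal (3 * c)"
      by (simp add: pos_divide_le_eq)
  qed
qed

theorem theorem3p9:
  fixes X :: "'a::metric_space set" and T :: "'a \<Rightarrow> 'a"
  assumes "compact X" and "diameter X = 1"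
    and "T ` X \<subseteq> X" and "continuous_on X T"
    and "partial_specification_property X T"
  shows "average_shadowing_property X T"
  unfolding average_shadowing_property_def
proof (intro allI impI)
  fix \<epsilon> :: real assume "\<epsilon> > 0"
  \<comment> \<open>The final estimate is \<open>3 * (6 * \<epsilon>')\<close>, and 19 > 18 makes it
    strictly smaller than \<open>\<epsilon>\<close>.\<close>
  define \<epsilon>' where "\<epsilon>' = \<epsilon> / 19"
  have eps': "\<epsilon>' > 0" using \<open>\<epsilon> > 0\<close> by (simp add: \<epsilon>'_def)
  have le1: "dist u v \<le> 1" if "u \<in> X" "v \<in> X" for u v
    using diameter_bounded_bound[OF compact_imp_bounded[OF assms(1)] that] assms(2) by simp
  note inX = funpow_in_self_map[OF assms(3)]
  obtain P where P: "infinite P" "partial_specification_with_periods X T P"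
    using assms(5) unfolding partial_specification_property_def by blast
  obtain M0 where M0: "\<And>r x a b. spaced_specification X M0 r x a b \<Longrightarrow>
    \<exists>n>0. \<exists>z\<in>X. (T ^^ n) z = z \<and>
      (\<forall>i\<in>{1..r}. (\<Sum>n=a i..<b i. dist ((T ^^ n) z) ((T ^^ n) (x i))) \<le> 2 * \<epsilon>' * real (b i - a i))"
    using partial_specification_traces_finite[OF assms(3) le1 P eps'] by blast
  \<comment> \<open>A specification requires strictly positive gaps, and \<open>M0\<close> may be
    0.\<close>
  define M where "M = Suc M0"
  \<comment> \<open>Each block of length \<open>L\<close> consists of a traced segment of length
    \<open>K > 0\<close> and a gap of length \<open>M\<close>; the gap is at most a fraction
    \<open>\<epsilon>'\<close> of the block.\<close>
  obtain L where L: "L > M" "real M \<le> \<epsilon>' * real L"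
  proof -
    obtain k where k: "real M / \<epsilon>' \<le> real k" using real_arch_simple by blast
    then have "real M / \<epsilon>' \<le> real (max k (Suc M))" by linarith
    then show thesis
      using eps' by (intro that[of "max k (Suc M)"]) (auto simp: pos_divide_le_eq mult.commute)
  qed
  define K where "K = L - M"
  have K: "K > 0" "K + M = L" using L by (auto simp: K_def)
  obtain \<eta> where \<eta>: "\<eta> > 0"
    "\<And>u i. (\<forall>i. u i \<in> X) \<Longrightarrow> (\<forall>i<L. dist (T (u i)) (u (Suc i)) < \<eta>) \<Longrightarrow> i \<le> L \<Longrightarrow>
      dist ((T ^^ i) (u 0)) (u i) < \<epsilon>'"
    using pseudo_orbit_close_to_orbit[OF assms(1,3,4) eps', of L] by metis
  \<comment> \<open>A block with an error of at least \<open>\<eta>\<close> costs at most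
    \<open>L\<close>, that is \<open>L / \<eta>\<close> per unit of error. With this
    \<open>\<delta>\<close>, such blocks add at most \<open>\<epsilon>'\<close> to the average over
    whole blocks.\<close>
  define \<delta> where "\<delta> = \<epsilon>' * \<eta> / real L"
  show "\<exists>\<delta>>0. \<forall>x. average_pseudo_orbit X T \<delta> x \<longrightarrow>
    (\<exists>z\<in>X. limsup (\<lambda>n. ereal (1 / real n * (\<Sum>j<n. dist ((T ^^ j) z) (x j)))) < ereal \<epsilon>)"
  proof (intro exI[of _ \<delta>] conjI allI impI)
    show "\<delta> > 0" using eps' \<eta>(1) L(1) by (simp add: \<delta>_def)
    fix x assume "average_pseudo_orbit X T \<delta> x"
    then obtain N where x: "\<And>i. x i \<in> X" and N: "N > 0"
      "\<And>n. n \<ge> N \<Longrightarrow> 1 / real n * (\<Sum>i<n. dist (T (x (i + 0))) (x (i + 0 + 1))) < \<delta>"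
      unfolding average_pseudo_orbit_def by blast
    define e where "e = (\<lambda>i. dist (T (x i)) (x (Suc i)))"
    have e: "(\<Sum>i<n. e i) \<le> \<delta> * real n" if "n \<ge> N" for n
      using N(2)[OF that] N(1) that by (simp add: e_def pos_divide_less_eq)

    \<comment> \<open>Trace the single segment of \<open>x (j * L)\<close> over the times below
      \<open>K\<close> by a periodic point, then pull that point back by \<open>j * L\<close>
      steps.\<close>
    have "\<exists>q\<in>X. (\<Sum>i<K. dist ((T ^^ (j * L + i)) q) ((T ^^ i) (x (j * L)))) \<le> 2 * \<epsilon>' * real K" for j
    proof -
      have "spaced_specification X M0 1 (\<lambda>_. x (j * L)) (\<lambda>_. 0) (\<lambda>_. K)"
        unfolding spaced_specification_def using x K(1) by simp
      from M0[OF this] obtain n p where p: "n > 0" "p \<in> X" "(T ^^ n) p = p"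
        "(\<Sum>n=0..<K. dist ((T ^^ n) p) ((T ^^ n) (x (j * L)))) \<le> 2 * \<epsilon>' * real K"
        by auto
      obtain q where q: "q \<in> X" "(T ^^ (j * L)) q = p"
        using periodic_point_preimage[OF p(3,1) assms(3) p(2)] .
      have "(T ^^ (j * L + i)) q = (T ^^ i) p" for i
        using q(2) by (simp add: funpow_add add.commute[of "j * L"])
      then show ?thesis using p(4) by (intro bexI[OF _ q(1)]) (simp add: lessThan_atLeast0)
    qed
    then obtain q where q: "\<And>j. q j \<in> X"
      "\<And>j. (\<Sum>i<K. dist ((T ^^ (j * L + i)) (q j)) ((T ^^ i) (x (j * L)))) \<le> 2 * \<epsilon>' * real K"
      by metis

    \<comment> \<open>A specification is nonempty and numbered from 1. So \<open>Suc r\<close>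
      segments are used, which covers \<open>r = 0\<close>, and segment \<open>i\<close> belongs to
      block \<open>i - 1\<close>.\<close>
    have "\<exists>z\<in>X. \<forall>j<r. (\<Sum>n=j * L..<j * L + K. dist ((T ^^ n) z) ((T ^^ n) (q j))) \<le> 2 * \<epsilon>' * real K"
      for r
    proof -
      have "b < a \<and> M0 \<le> a - b"
        if "i \<in> {2..Suc r}" "a = (i - 1) * L" "b = (i - 1 - 1) * L + K" for i a b
      proof -
        \<comment> \<open>This form of \<open>i\<close> removes the truncated subtractions:
          consecutive segments are then exactly \<open>M\<close> apart.\<close>
        have "i = Suc (Suc (i - 2))" using that(1) by auto
        then obtain k where "i = Suc (Suc k)" ..
        then have "a = b + M" using that K(2) by simp
        then show ?thesis by (simp add: M_def)
      qed
      then have "spaced_specification X M0 (Suc r) (\<lambda>i. q (i - 1)) (\<lambda>i. (i - 1) * L)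
          (\<lambda>i. (i - 1) * L + K)"
        unfolding spaced_specification_def using q(1) K(1) by simp
      from M0[OF this] obtain z where z: "z \<in> X" "\<And>i. i \<in> {1..Suc r} \<Longrightarrow>
          (\<Sum>n=(i - 1) * L..<(i - 1) * L + K. dist ((T ^^ n) z) ((T ^^ n) (q (i - 1))))
            \<le> 2 * \<epsilon>' * real K"
        by auto
      then show ?thesis
        using z(2)[of "Suc _"] by (intro bexI[of _ z]) auto
    qed
    then obtain z where z: "z \<in> X"
      "\<And>j. (\<Sum>n=j * L..<j * L + K. dist ((T ^^ n) z) ((T ^^ n) (q j))) \<le> 2 * \<epsilon>' * real K"
      using traces_infinite_of_traces_finite[OF assms(1,3,4),
          where a = "\<lambda>j. j * L" and b = "\<lambda>j. j * L + K" and x = q and B = "\<lambda>_. 2 * \<epsilon>' * real K"]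
      by blast

    let ?f = "\<lambda>n. dist ((T ^^ n) z) (x n)"
    have f1: "?f n \<le> 1" for n
      using le1 inX z(1) x by blast
    have block: "(\<Sum>i<L. ?f (j * L + i))
        \<le> real L * (6 * \<epsilon>') + real L / \<eta> * (\<Sum>i<L. e (j * L + i))" for j
    proof (cases "\<forall>i<L. e (j * L + i) < \<eta>")
      case True
      have close: "dist ((T ^^ i) (x (j * L))) (x (j * L + i)) < \<epsilon>'" if "i \<le> L" for i
        using \<eta>(2)[of "\<lambda>i. x (j * L + i)" i] True that x by (simp add: e_def)
      \<comment> \<open>The route goes from \<open>z\<close> to the orbit of \<open>q j\<close>, on
        to the true orbit of \<open>x (j * L)\<close>, and from there to the pseudo-orbit. Summed
        over the segment, the three legs cost 2, 2 and 1 times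
        \<open>\<epsilon>' * K\<close>.\<close>
      have tr: "?f (j * L + i) \<le> dist ((T ^^ (j * L + i)) z) ((T ^^ (j * L + i)) (q j))
          + dist ((T ^^ (j * L + i)) (q j)) ((T ^^ i) (x (j * L))) + \<epsilon>'" if "i < K" for i
      proof -
        have "i \<le> L" using that K(2) by simp
        then show ?thesis
          using close[of i]
            dist_triangle[of "(T ^^ (j * L + i)) z" "x (j * L + i)" "(T ^^ (j * L + i)) (q j)"]
            dist_triangle[of "(T ^^ (j * L + i)) (q j)" "x (j * L + i)" "(T ^^ i) (x (j * L))"]
          by linarith
      qed
      have zq: "(\<Sum>i<K. dist ((T ^^ (j * L + i)) z) ((T ^^ (j * L + i)) (q j))) \<le> 2 * \<epsilon>' * real K"
        using z(2)[of j] sum.shift_bounds_nat_ivl[of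
            "\<lambda>n. dist ((T ^^ n) z) ((T ^^ n) (q j))" 0 "j * L" K]
        by (simp add: lessThan_atLeast0 add.commute)
      have "(\<Sum>i<K. ?f (j * L + i))
          \<le> (\<Sum>i<K. dist ((T ^^ (j * L + i)) z) ((T ^^ (j * L + i)) (q j))
          + dist ((T ^^ (j * L + i)) (q j)) ((T ^^ i) (x (j * L))) + \<epsilon>')"
        by (intro sum_mono tr) simp
      also have "\<dots> \<le> 2 * \<epsilon>' * real K + 2 * \<epsilon>' * real K + real K * \<epsilon>'"
        using zq q(2)[of j] by (simp add: sum.distrib)
      also have "\<dots> \<le> 5 * \<epsilon>' * real L"
        using eps' K(2) by (auto simp: algebra_simps)
      finally have 1: "(\<Sum>i<K. ?f (j * L + i)) \<le> 5 * \<epsilon>' * real L" .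
      \<comment> \<open>The \<open>M\<close> times in the gap are bounded trivially by 1
        each.\<close>
      have "(\<Sum>i=K..<L. ?f (j * L + i)) \<le> real (card {K..<L}) * 1"
        by (rule sum_bounded_above) (rule f1)
      also have "\<dots> \<le> \<epsilon>' * real L" using L(2) K(2) by simp
      finally have 2: "(\<Sum>i=K..<L. ?f (j * L + i)) \<le> \<epsilon>' * real L" .
      have "(\<Sum>i<L. ?f (j * L + i)) = (\<Sum>i<K. ?f (j * L + i)) + (\<Sum>i=K..<L. ?f (j * L + i))"
        unfolding lessThan_atLeast0 using K(2) by (intro sum.atLeastLessThan_concat[symmetric]) auto
      then have "(\<Sum>i<L. ?f (j * L + i)) \<le> real L * (6 * \<epsilon>')"
        using 1 2 by (simp add: algebra_simps)
      moreover have "real L / \<eta> * (\<Sum>i<L. e (j * L + i)) \<ge> 0"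
        using \<eta>(1) by (intro mult_nonneg_nonneg sum_nonneg) (auto simp: e_def)
      ultimately show ?thesis by linarith
    next
      case False
      then obtain i where i: "i < L" "\<eta> \<le> e (j * L + i)" by force
      \<comment> \<open>Markov's inequality on one block: a single error of size
        \<open>\<eta>\<close> makes the error term at least \<open>L\<close>, the trivial bound for
        the whole block.\<close>
      have "e (j * L + i) \<le> (\<Sum>i<L. e (j * L + i))"
        using i(1) by (intro member_le_sum) (auto simp: e_def)
      with i(2) have "real L / \<eta> * \<eta> \<le> real L / \<eta> * (\<Sum>i<L. e (j * L + i))"
        using \<eta>(1) by (intro mult_left_mono) auto
      then have "real L \<le> real L / \<eta> * (\<Sum>i<L. e (j * L + i))"
        using \<eta>(1) by simp
      moreover have "(\<Sum>i<L. ?f (j * L + i)) \<le> real L"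
        using sum_bounded_above[of "{..<L}" "\<lambda>i. ?f (j * L + i)" 1, OF f1] by simp
      moreover have "real L * (6 * \<epsilon>') \<ge> 0" using eps' by simp
      ultimately show ?thesis by linarith
    qed

    have "limsup (\<lambda>n. ereal (1 / real n * (\<Sum>j<n. ?f j))) \<le> ereal (3 * (6 * \<epsilon>'))"
    proof (rule limsup_average_le_of_block_sums[OF _ _ _ _ block e])
      show "real L / \<eta> * \<delta> \<le> 6 * \<epsilon>'"
        using \<eta>(1) L(1) eps' by (simp add: \<delta>_def)
    qed (use L(1) \<eta>(1) eps' in auto)
    also have "\<dots> < ereal \<epsilon>"
      using \<open>\<epsilon> > 0\<close> by (simp add: \<epsilon>'_def)
    finally show "\<exists>z\<in>X. limsup (\<lambda>n. ereal (1 / real n * (\<Sum>j<n. dist ((T ^^ j) z) (x j)))) < ereal \<epsilon>"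
      using z(1) by blast
  qed
qed

end
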